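(* There is congruence in the direction of the preconditioning conversion for each of the PCGS algorithms. Precisely, let $A,M\in\mathbb{R}^{n\times n}$ be nonsingular and $b,x_0\in\mathbb{R}^n$, and let X be any of the Algorithms C, L, I1, I2 described in the context. For every factorization $M=M_LM_R$ with $M_L,M_R$ nonsingular (two-sided direction), in particular for $M_L=I,\ M_R=M$ (right direction) and for $M_L=M,\ M_R=I$ (left direction), substituting the preconditioning conversion associated with X into the CGS under the preconditioned system reduces it to one and the same algorithm description, namely Algorithm X: the converted (tilde) quantities satisfy the recurrences of the CGS under the preconditioned system with scalars $\alpha_k,\beta_k$ if and only if the unconverted quantities satisfy the recurrences of Algorithm X with the same scalars $\alpha_k,\beta_k$.
   Context: $(\cdot,\cdot)$ is the standard inner product on $\mathbb{R}^n$ and $M^{-\mathsf T}=(M^{-1})^{\mathsf T}$. All algorithms start with $\beta_{-1}=0$ (so terms with index $-1$ vanish) and run for $k=0,1,2,\dots$ as long as the denominators are nonzero. CGS under the preconditioned system: given $\tilde A,\tilde b,\tilde x_0,\tilde r^\sharp_0$, $\tilde r_0=\tilde b-\tilde A\tilde x_0$; $\tilde u_k=\tilde r_k+\beta_{k-1}\tilde q_{k-1}$; $\tilde p_k=\tilde u_k+\beta_{k-1}(\tilde q_{k-1}+\beta_{k-1}\tilde p_{k-1})$; $\alpha_k=(\tilde r^\sharp_0,\tilde r_k)/(\tilde r^\sharp_0,\tilde A\tilde p_k)$; $\tilde q_k=\tilde u_k-\alpha_k\tilde A\tilde p_k$; $\tilde x_{k+1}=\tilde x_k+\alpha_k(\tilde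 u_k+\tilde q_k)$; $\tilde r_{k+1}=\tilde r_k-\alpha_k\tilde A(\tilde u_k+\tilde q_k)$; $\beta_k=(\tilde r^\sharp_0,\tilde r_{k+1})/(\tilde r^\sharp_0,\tilde r_k)$. All conversions use $\tilde A=M_L^{-1}AM_R^{-1}$, $\tilde x_k=M_Rx_k$, $\tilde b=M_L^{-1}b$, where $M=M_LM_R$ is the preconditioner. The remaining vectors are converted, and the algorithms defined, as follows. Algorithm C (conventional). Conversion: $\tilde r_k=M_L^{-1}r_k$, $\tilde r^\sharp_0=M_L^{\mathsf T}r^\flat_0$, $\tilde p_k=M_L^{-1}p_k$, $\tilde u_k=M_L^{-1}u_k$, $\tilde q_k=M_L^{-1}q_k$. Algorithm: $r_0=b-Ax_0$; $u_k=r_k+\beta_{k-1}q_{k-1}$; $p_k=u_k+\beta_{k-1}(q_{k-1}+\beta_{k-1}p_{k-1})$; $\alpha_k=(r^\flat_0,r_k)/(r^\flat_0,AM^{-1}p_k)$; $q_k=u_k-\alpha_kAM^{-1}p_k$; $x_{k+1}=x_k+\alpha_kM^{-1}(u_k+q_k)$; $r_{k+1}=r_k-\alpha_kAM^{-1}(u_k+q_k)$; $\beta_k=(r^\flat_0,r_{k+1})/(r^\flat_0,r_k)$. Algorithm L (left-PCGS). Conversion: $\tilde r_k=M_Rr^+_k$, $\tilde r^\sharp_0=M_R^{-\mathsf T}r^\sharp_0$, $\tilde p_k=M_Rp^+_k$, $\tilde u_k=M_Ru^+_k$, $\tilde q_k=M_Rq^+_k$. Algorithm: $r^+_0=M^{-1}(b-Ax_0)$;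 $u^+_k=r^+_k+\beta_{k-1}q^+_{k-1}$; $p^+_k=u^+_k+\beta_{k-1}(q^+_{k-1}+\beta_{k-1}p^+_{k-1})$; $\alpha_k=(r^\sharp_0,r^+_k)/(r^\sharp_0,M^{-1}Ap^+_k)$; $q^+_k=u^+_k-\alpha_kM^{-1}Ap^+_k$; $x_{k+1}=x_k+\alpha_k(u^+_k+q^+_k)$; $r^+_{k+1}=r^+_k-\alpha_kM^{-1}A(u^+_k+q^+_k)$; $\beta_k=(r^\sharp_0,r^+_{k+1})/(r^\sharp_0,r^+_k)$. Algorithm I1 (Improved1). Conversion: $\tilde r_k=M_L^{-1}r_k$, $\tilde r^\sharp_0=M_R^{-\mathsf T}r^\sharp_0$, $\tilde p_k=M_Rp^+_k$, $\tilde u_k=M_Ru^+_k$, $\tilde q_k=M_Rq^+_k$. Algorithm: $r_0=b-Ax_0$; $u^+_k=M^{-1}r_k+\beta_{k-1}q^+_{k-1}$; $p^+_k=u^+_k+\beta_{k-1}(q^+_{k-1}+\beta_{k-1}p^+_{k-1})$; $\alpha_k=(r^\sharp_0,M^{-1}r_k)/(r^\sharp_0,M^{-1}Ap^+_k)$; $q^+_k=u^+_k-\alpha_kM^{-1}Ap^+_k$; $x_{k+1}=x_k+\alpha_k(u^+_k+q^+_k)$; $r_{k+1}=r_k-\alpha_kA(u^+_k+q^+_k)$; $\beta_k=(r^\sharp_0,M^{-1}r_{k+1})/(r^\sharp_0,M^{-1}r_k)$. Algorithm I2 (Improved2). Conversion: $\tilde r_k=M_L^{-1}r_k$, $\tilde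 r^\sharp_0=M_R^{-\mathsf T}r^\sharp_0$, $\tilde p_k=M_L^{-1}p_k$, $\tilde u_k=M_L^{-1}u_k$, $\tilde q_k=M_L^{-1}q_k$. Algorithm: $r_0=b-Ax_0$; $u_k=r_k+\beta_{k-1}q_{k-1}$; $p_k=u_k+\beta_{k-1}(q_{k-1}+\beta_{k-1}p_{k-1})$; $\alpha_k=(M^{-\mathsf T}r^\sharp_0,r_k)/(M^{-\mathsf T}r^\sharp_0,AM^{-1}p_k)$; $q_k=u_k-\alpha_kAM^{-1}p_k$; $x_{k+1}=x_k+\alpha_kM^{-1}(u_k+q_k)$; $r_{k+1}=r_k-\alpha_kAM^{-1}(u_k+q_k)$; $\beta_k=(M^{-\mathsf T}r^\sharp_0,r_{k+1})/(M^{-\mathsf T}r^\sharp_0,r_k)$. (In Algorithms L, I1, I2 the symbol $\tilde r^\sharp_0$ is the shadow vector of the preconditioned system and $r^\sharp_0$ the unconverted one.) Congruence, by the paper's definition, means that all directions (two-sided, right, left) of the preconditioning conversion of the system, solution and all other vectors of the method reduce to one and the same algorithm description. *)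

theory Defs
  imports "HOL-Analysis.Analysis"
begin

text \<open>
  The shadow vector, the sequences of the approximate solutions \<open>x\<close>, the residuals \<open>r\<close> and the
  auxiliary vectors \<open>u\<close>, \<open>p\<close>, \<open>q\<close>, and the scalars \<open>\<alpha>\<close>, \<open>\<beta>\<close>.
\<close>

datatype 'v quantities =
  Quantities 'v "nat \<Rightarrow> 'v" "nat \<Rightarrow> 'v" "nat \<Rightarrow> 'v" "nat \<Rightarrow> 'v" "nat \<Rightarrow> 'v"
    "nat \<Rightarrow> real" "nat \<Rightarrow> real"

text \<open>
  \<open>prev f k\<close> is the entry with index \<open>k - 1\<close>. For the scalars it implements the convention
  that the entry with index \<open>-1\<close> is zero; for vectors its value at \<open>0\<close> is irrelevant, as it
  only occurs multiplied by that scalar.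
\<close>

definition prev :: "(nat \<Rightarrow> 'a::zero) \<Rightarrow> nat \<Rightarrow> 'a" where
  "prev f k = (case k of 0 \<Rightarrow> 0 | Suc j \<Rightarrow> f j)"

text \<open>
  An iteration that stops at the first vanishing denominator. Step \<open>k\<close> is reached if all
  denominators \<open>d\<^sub>\<alpha>\<close>, \<open>d\<^sub>\<beta>\<close> of the earlier steps are nonzero. Its part \<open>S\<^sub>1\<close> contains no
  division, \<open>S\<^sub>2\<close> begins with the division by \<open>d\<^sub>\<alpha> k\<close>, and \<open>S\<^sub>3\<close> with the division by \<open>d\<^sub>\<beta> k\<close>.
  Nothing is required of the quantities that are not computed before the stop.
\<close>

definition while_nonzero ::
    "(nat \<Rightarrow> real) \<Rightarrow> (nat \<Rightarrow> real) \<Rightarrow>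
     (nat \<Rightarrow> bool) \<Rightarrow> (nat \<Rightarrow> bool) \<Rightarrow> (nat \<Rightarrow> bool) \<Rightarrow> bool" where
  "while_nonzero d\<^sub>\<alpha> d\<^sub>\<beta> S\<^sub>1 S\<^sub>2 S\<^sub>3 \<longleftrightarrow>
    (\<forall>k. (\<forall>j<k. d\<^sub>\<alpha> j \<noteq> 0 \<and> d\<^sub>\<beta> j \<noteq> 0) \<longrightarrow>
      S\<^sub>1 k \<and> (d\<^sub>\<alpha> k \<noteq> 0 \<longrightarrow> S\<^sub>2 k \<and> (d\<^sub>\<beta> k \<noteq> 0 \<longrightarrow> S\<^sub>3 k)))"

fun CGS ::
    "real^'n^'n \<Rightarrow> real^'n \<Rightarrow> real^'n \<Rightarrow> (real^'n) quantities \<Rightarrow> bool" where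
  "CGS A b x\<^sub>0 (Quantities rs x r u p q \<alpha> \<beta>) \<longleftrightarrow>
    x 0 = x\<^sub>0 \<and> r 0 = b - A *v x\<^sub>0 \<and>
    while_nonzero (\<lambda>k. rs \<bullet> (A *v p k)) (\<lambda>k. rs \<bullet> r k)
      (\<lambda>k. u k = r k + prev \<beta> k *\<^sub>R prev q k \<and>
           p k = u k + prev \<beta> k *\<^sub>R (prev q k + prev \<beta> k *\<^sub>R prev p k))
      (\<lambda>k. \<alpha> k = (rs \<bullet> r k) / (rs \<bullet> (A *v p k)) \<and>
           q k = u k - \<alpha> k *\<^sub>R (A *v p k) \<and>
           x (Suc k) = x k + \<alpha> k *\<^sub>R (u k + q k) \<and>
           r (Suc k) = r k - \<alpha> k *\<^sub>R (A *v (u k + q k)))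
      (\<lambda>k. \<beta> k = (rs \<bullet> r (Suc k)) / (rs \<bullet> r k))"

text \<open>
  The preconditioned algorithms, in terms of the unconverted quantities. In \<open>PCGS_left\<close> the
  components \<open>r\<close>, \<open>u\<close>, \<open>p\<close>, \<open>q\<close>, and in \<open>PCGS_improved1\<close> the components \<open>u\<close>, \<open>p\<close>, \<open>q\<close>, are
  the vectors usually marked with a superscript plus.
\<close>

fun PCGS_conventional ::
    "real^'n^'n \<Rightarrow> real^'n^'n \<Rightarrow> real^'n \<Rightarrow> real^'n \<Rightarrow> (real^'n) quantities \<Rightarrow> bool" where
  "PCGS_conventional A M b x\<^sub>0 (Quantities rb x r u p q \<alpha> \<beta>) \<longleftrightarrow>
    x 0 = x\<^sub>0 \<and> r 0 = b - A *v x\<^sub>0 \<and>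
    while_nonzero (\<lambda>k. rb \<bullet> (A *v (matrix_inv M *v p k))) (\<lambda>k. rb \<bullet> r k)
      (\<lambda>k. u k = r k + prev \<beta> k *\<^sub>R prev q k \<and>
           p k = u k + prev \<beta> k *\<^sub>R (prev q k + prev \<beta> k *\<^sub>R prev p k))
      (\<lambda>k. \<alpha> k = (rb \<bullet> r k) / (rb \<bullet> (A *v (matrix_inv M *v p k))) \<and>
           q k = u k - \<alpha> k *\<^sub>R (A *v (matrix_inv M *v p k)) \<and>
           x (Suc k) = x k + \<alpha> k *\<^sub>R (matrix_inv M *v (u k + q k)) \<and>
           r (Suc k) = r k - \<alpha> k *\<^sub>R (A *v (matrix_inv M *v (u k + q k))))
      (\<lambda>k. \<beta> k = (rb \<bullet> r (Suc k)) / (rb \<bullet> r k))"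

fun PCGS_left ::
    "real^'n^'n \<Rightarrow> real^'n^'n \<Rightarrow> real^'n \<Rightarrow> real^'n \<Rightarrow> (real^'n) quantities \<Rightarrow> bool" where
  "PCGS_left A M b x\<^sub>0 (Quantities rs x r u p q \<alpha> \<beta>) \<longleftrightarrow>
    x 0 = x\<^sub>0 \<and> r 0 = matrix_inv M *v (b - A *v x\<^sub>0) \<and>
    while_nonzero (\<lambda>k. rs \<bullet> (matrix_inv M *v (A *v p k))) (\<lambda>k. rs \<bullet> r k)
      (\<lambda>k. u k = r k + prev \<beta> k *\<^sub>R prev q k \<and>
           p k = u k + prev \<beta> k *\<^sub>R (prev q k + prev \<beta> k *\<^sub>R prev p k))
      (\<lambda>k. \<alpha> k = (rs \<bullet> r k) / (rs \<bullet> (matrix_inv M *v (A *v p k))) \<and>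
           q k = u k - \<alpha> k *\<^sub>R (matrix_inv M *v (A *v p k)) \<and>
           x (Suc k) = x k + \<alpha> k *\<^sub>R (u k + q k) \<and>
           r (Suc k) = r k - \<alpha> k *\<^sub>R (matrix_inv M *v (A *v (u k + q k))))
      (\<lambda>k. \<beta> k = (rs \<bullet> r (Suc k)) / (rs \<bullet> r k))"

fun PCGS_improved1 ::
    "real^'n^'n \<Rightarrow> real^'n^'n \<Rightarrow> real^'n \<Rightarrow> real^'n \<Rightarrow> (real^'n) quantities \<Rightarrow> bool" where
  "PCGS_improved1 A M b x\<^sub>0 (Quantities rs x r u p q \<alpha> \<beta>) \<longleftrightarrow>
    x 0 = x\<^sub>0 \<and> r 0 = b - A *v x\<^sub>0 \<and>
    while_nonzero (\<lambda>k. rs \<bullet> (matrix_inv M *v (A *v p k))) (\<lambda>k. rs \<bullet> (matrix_inv M *v r k))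
      (\<lambda>k. u k = matrix_inv M *v r k + prev \<beta> k *\<^sub>R prev q k \<and>
           p k = u k + prev \<beta> k *\<^sub>R (prev q k + prev \<beta> k *\<^sub>R prev p k))
      (\<lambda>k. \<alpha> k = (rs \<bullet> (matrix_inv M *v r k)) / (rs \<bullet> (matrix_inv M *v (A *v p k))) \<and>
           q k = u k - \<alpha> k *\<^sub>R (matrix_inv M *v (A *v p k)) \<and>
           x (Suc k) = x k + \<alpha> k *\<^sub>R (u k + q k) \<and>
           r (Suc k) = r k - \<alpha> k *\<^sub>R (A *v (u k + q k)))
      (\<lambda>k. \<beta> k = (rs \<bullet> (matrix_inv M *v r (Suc k))) / (rs \<bullet> (matrix_inv M *v r k)))"

fun PCGS_improved2 ::
    "real^'n^'n \<Rightarrow> real^'n^'n \<Rightarrow> real^'n \<Rightarrow> real^'n \<Rightarrow> (real^'n) quantities \<Rightarrow> bool" where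
  "PCGS_improved2 A M b x\<^sub>0 (Quantities rs x r u p q \<alpha> \<beta>) \<longleftrightarrow>
    x 0 = x\<^sub>0 \<and> r 0 = b - A *v x\<^sub>0 \<and>
    while_nonzero
      (\<lambda>k. (transpose (matrix_inv M) *v rs) \<bullet> (A *v (matrix_inv M *v p k)))
      (\<lambda>k. (transpose (matrix_inv M) *v rs) \<bullet> r k)
      (\<lambda>k. u k = r k + prev \<beta> k *\<^sub>R prev q k \<and>
           p k = u k + prev \<beta> k *\<^sub>R (prev q k + prev \<beta> k *\<^sub>R prev p k))
      (\<lambda>k. \<alpha> k = ((transpose (matrix_inv M) *v rs) \<bullet> r k) /
                 ((transpose (matrix_inv M) *v rs) \<bullet> (A *v (matrix_inv M *v p k))) \<and>
           q k = u k - \<alpha> k *\<^sub>R (A *v (matrix_inv M *v p k)) \<and>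
           x (Suc k) = x k + \<alpha> k *\<^sub>R (matrix_inv M *v (u k + q k)) \<and>
           r (Suc k) = r k - \<alpha> k *\<^sub>R (A *v (matrix_inv M *v (u k + q k))))
      (\<lambda>k. \<beta> k = ((transpose (matrix_inv M) *v rs) \<bullet> r (Suc k)) /
                 ((transpose (matrix_inv M) *v rs) \<bullet> r k))"

text \<open>
  The preconditioning conversions, mapping unconverted quantities to the converted (tilde)
  quantities. They leave the scalars unchanged.
\<close>

fun conv_conventional ::
    "real^'n^'n \<Rightarrow> real^'n^'n \<Rightarrow> (real^'n) quantities \<Rightarrow> (real^'n) quantities" where
  "conv_conventional ML MR (Quantities rb x r u p q \<alpha> \<beta>) =
    Quantities (transpose ML *v rb) (\<lambda>k. MR *v x k) (\<lambda>k. matrix_inv ML *v r k)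
      (\<lambda>k. matrix_inv ML *v u k) (\<lambda>k. matrix_inv ML *v p k) (\<lambda>k. matrix_inv ML *v q k) \<alpha> \<beta>"

fun conv_left ::
    "real^'n^'n \<Rightarrow> real^'n^'n \<Rightarrow> (real^'n) quantities \<Rightarrow> (real^'n) quantities" where
  "conv_left ML MR (Quantities rs x r u p q \<alpha> \<beta>) =
    Quantities (transpose (matrix_inv MR) *v rs) (\<lambda>k. MR *v x k) (\<lambda>k. MR *v r k)
      (\<lambda>k. MR *v u k) (\<lambda>k. MR *v p k) (\<lambda>k. MR *v q k) \<alpha> \<beta>"

fun conv_improved1 ::
    "real^'n^'n \<Rightarrow> real^'n^'n \<Rightarrow> (real^'n) quantities \<Rightarrow> (real^'n) quantities" where
  "conv_improved1 ML MR (Quantities rs x r u p q \<alpha> \<beta>) =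
    Quantities (transpose (matrix_inv MR) *v rs) (\<lambda>k. MR *v x k) (\<lambda>k. matrix_inv ML *v r k)
      (\<lambda>k. MR *v u k) (\<lambda>k. MR *v p k) (\<lambda>k. MR *v q k) \<alpha> \<beta>"

fun conv_improved2 ::
    "real^'n^'n \<Rightarrow> real^'n^'n \<Rightarrow> (real^'n) quantities \<Rightarrow> (real^'n) quantities" where
  "conv_improved2 ML MR (Quantities rs x r u p q \<alpha> \<beta>) =
    Quantities (transpose (matrix_inv MR) *v rs) (\<lambda>k. MR *v x k) (\<lambda>k. matrix_inv ML *v r k)
      (\<lambda>k. matrix_inv ML *v u k) (\<lambda>k. matrix_inv ML *v p k) (\<lambda>k. matrix_inv ML *v q k) \<alpha> \<beta>"

text \<open>
  Substituting the conversion \<open>conv\<close> for the factors \<open>ML\<close>, \<open>MR\<close> into the CGS under the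
  preconditioned system yields the algorithm description \<open>X\<close>.
\<close>

definition reduces_to ::
    "(real^'n^'n \<Rightarrow> real^'n^'n \<Rightarrow> (real^'n) quantities \<Rightarrow> (real^'n) quantities) \<Rightarrow>
     (real^'n^'n \<Rightarrow> real^'n^'n \<Rightarrow> real^'n \<Rightarrow> real^'n \<Rightarrow> (real^'n) quantities \<Rightarrow> bool) \<Rightarrow>
     real^'n^'n \<Rightarrow> real^'n^'n \<Rightarrow> real^'n \<Rightarrow> real^'n \<Rightarrow> real^'n^'n \<Rightarrow> real^'n^'n \<Rightarrow> bool" where
  "reduces_to conv X A M b x\<^sub>0 ML MR \<longleftrightarrow>
    (\<forall>v. CGS (matrix_inv ML ** A ** matrix_inv MR) (matrix_inv ML *v b) (MR *v x\<^sub>0) (conv ML MR v)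
         \<longleftrightarrow> X A M b x\<^sub>0 v)"

text \<open>
  Congruence: the two-sided, the right and the left direction of the conversion all reduce to
  the same algorithm description \<open>X\<close>.
\<close>

definition congruence ::
    "(real^'n^'n \<Rightarrow> real^'n^'n \<Rightarrow> (real^'n) quantities \<Rightarrow> (real^'n) quantities) \<Rightarrow>
     (real^'n^'n \<Rightarrow> real^'n^'n \<Rightarrow> real^'n \<Rightarrow> real^'n \<Rightarrow> (real^'n) quantities \<Rightarrow> bool) \<Rightarrow>
     real^'n^'n \<Rightarrow> real^'n^'n \<Rightarrow> real^'n \<Rightarrow> real^'n \<Rightarrow> bool" where
  "congruence conv X A M b x\<^sub>0 \<longleftrightarrow>
    (\<forall>ML MR. invertible ML \<and> invertible MR \<and> M = ML ** MR \<longrightarrow>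
       reduces_to conv X A M b x\<^sub>0 ML MR) \<and>
    reduces_to conv X A M b x\<^sub>0 (mat 1) M \<and>
    reduces_to conv X A M b x\<^sub>0 M (mat 1)"

end

theory Submission
  imports Defs
begin

text \<open>
  Whatever the factorization \<open>M = L R\<close>, the preconditioned matrix is similar to two matrices
  that depend on \<open>M\<close> only:
  \<open>L\<^sup>-\<^sup>1 A R\<^sup>-\<^sup>1 = L\<^sup>-\<^sup>1 (A M\<^sup>-\<^sup>1) L = R (M\<^sup>-\<^sup>1 A) R\<^sup>-\<^sup>1\<close>.
  CGS does not see a change of basis: if all vectors are transformed by \<open>T\<close> and the shadow vector
  by \<open>T\<^sup>-\<^sup>T\<close>, every inner product with the shadow vector is preserved, hence so are all scalars and
  all tests for a zero denominator, and every vector recurrence is multiplied by the invertible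
  \<open>T\<close> (\<open>CGS_change_basis\<close>).

  Every one of the four conversions is such a change of basis, preceded by a substitution in which
  only \<open>M\<close> occurs. With \<open>T = L\<^sup>-\<^sup>1\<close> the conventional algorithm is CGS for \<open>A M\<^sup>-\<^sup>1 y = b\<close> with
  \<open>y = M x\<close>, and Improved2 is the same with \<open>M\<^sup>-\<^sup>T r\<^sup>\<sharp>\<close> as the shadow vector. With \<open>T = R\<close> the left
  algorithm is CGS for \<open>M\<^sup>-\<^sup>1 A x = M\<^sup>-\<^sup>1 b\<close>, and Improved1 is the same with the residual written as
  \<open>M\<^sup>-\<^sup>1 r\<close>. The factors have disappeared from these descriptions, so all directions give the same
  algorithm; the right and the left direction are the factorizations \<open>I M\<close> and \<open>M I\<close>.
\<close>

lemma matrix_inv_mult_cancel: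
  fixes P :: "real^'n^'n"
  assumes "invertible P"
  shows "P ** matrix_inv P = mat 1" and "matrix_inv P ** P = mat 1"
proof -
  have "P ** matrix_inv P = mat 1 \<and> matrix_inv P ** P = mat 1"
    using assms unfolding invertible_def matrix_inv_def by (rule someI_ex)
  then show "P ** matrix_inv P = mat 1" and "matrix_inv P ** P = mat 1"
    by simp_all
qed

lemma matrix_inv_eqI:
  fixes P Q :: "real^'n^'n"
  assumes "P ** Q = mat 1" and "Q ** P = mat 1"
  shows "matrix_inv P = Q"
proof -
  have "invertible P"
    using assms by (auto simp: invertible_def)
  then have "matrix_inv P ** (P ** Q) = Q"
    by (simp add: matrix_mul_assoc matrix_inv_mult_cancel)
  then show ?thesis
    by (simp add: assms(1))
qed

lemma matrix_inv_cancel: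
  fixes P :: "real^'n^'n"
  assumes "invertible P"
  shows "P *v (matrix_inv P *v v) = v" and "matrix_inv P *v (P *v v) = v"
  using assms by (simp_all add: matrix_vector_mul_assoc matrix_inv_mult_cancel)

lemma matrix_vector_cancel:
  fixes P :: "real^'n^'n"
  assumes "invertible P"
  shows "P *v v = P *v w \<longleftrightarrow> v = w"
  by (metis assms matrix_inv_cancel(2))

lemma invertible_matrix_inv:
  fixes P :: "real^'n^'n"
  assumes "invertible P"
  shows "invertible (matrix_inv P)"
  using assms by (meson invertible_def matrix_inv_mult_cancel)

lemma matrix_inv_matrix_inv:
  fixes P :: "real^'n^'n"
  assumes "invertible P"
  shows "matrix_inv (matrix_inv P) = P"
  using assms by (intro matrix_inv_eqI matrix_inv_mult_cancel)

lemma matrix_inv_mult: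
  fixes P Q :: "real^'n^'n"
  assumes "invertible P" and "invertible Q"
  shows "matrix_inv (P ** Q) = matrix_inv Q ** matrix_inv P"
proof (rule matrix_inv_eqI)
  have "P ** Q ** (matrix_inv Q ** matrix_inv P) = P ** (Q ** matrix_inv Q) ** matrix_inv P"
    by (simp only: matrix_mul_assoc)
  then show "P ** Q ** (matrix_inv Q ** matrix_inv P) = mat 1"
    using assms by (simp add: matrix_inv_mult_cancel)
  have "matrix_inv Q ** matrix_inv P ** (P ** Q) = matrix_inv Q ** (matrix_inv P ** P) ** Q"
    by (simp only: matrix_mul_assoc)
  then show "matrix_inv Q ** matrix_inv P ** (P ** Q) = mat 1"
    using assms by (simp add: matrix_inv_mult_cancel)
qed

text \<open>
  This includes \<open>k = 0\<close>, because the default entry \<open>0\<close> is fixed by every linear map.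
\<close>

lemma prev_matrix_mult:
  fixes P :: "real^'n^'n"
  shows "prev (\<lambda>k. P *v f k) k = P *v prev f k"
  by (cases k) (simp_all add: prev_def)

text \<open>
  The shadow vector is dual to the others: \<open>T\<^sup>-\<^sup>T\<close> is what keeps its inner products with them.
\<close>

fun change_basis :: "real^'n^'n \<Rightarrow> (real^'n) quantities \<Rightarrow> (real^'n) quantities" where
  "change_basis T (Quantities rs x r u p q \<alpha> \<beta>) =
    Quantities (transpose (matrix_inv T) *v rs) (\<lambda>k. T *v x k) (\<lambda>k. T *v r k)
      (\<lambda>k. T *v u k) (\<lambda>k. T *v p k) (\<lambda>k. T *v q k) \<alpha> \<beta>"

lemma CGS_change_basis:
  fixes T B :: "real^'n^'n"
  assumes T: "invertible T"
  shows "CGS (T ** B ** matrix_inv T) (T *v b) (T *v x\<^sub>0) (change_basis T v) \<longleftrightarrow> CGS B b x\<^sub>0 v"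
proof (cases v)
  case (Quantities rs x r u p q \<alpha> \<beta>)
  have similar: "(T ** B ** matrix_inv T) *v (T *v w) = T *v (B *v w)" for w
    using T by (simp add: matrix_inv_cancel flip: matrix_vector_mul_assoc)
  have inner: "(rs v* matrix_inv T) \<bullet> (T *v w) = rs \<bullet> w" for w
    using T by (simp add: dot_lmul_matrix matrix_inv_cancel)
  show ?thesis
    \<comment> \<open>Collecting \<open>T\<close> at the front of both sides of each vector recurrence lets it be cancelled.\<close>
    by (simp add: Quantities similar inner prev_matrix_mult matrix_vector_cancel[OF T]
        flip: matrix_vector_mult_scaleR matrix_vector_right_distrib
          matrix_vector_mult_diff_distrib)
qed

section \<open>The algorithms without the factors of the preconditioner\<close>

text \<open>
  Only the recurrence of \<open>x\<close> differs: multiplied by \<open>M\<close>, it becomes the one of \<open>y = M x\<close>, in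
  which the correction is no longer preconditioned.
\<close>

lemma PCGS_conventional_iff_CGS:
  fixes A M :: "real^'n^'n"
  assumes "invertible M"
  shows "PCGS_conventional A M b x\<^sub>0 (Quantities rb x r u p q \<alpha> \<beta>) \<longleftrightarrow>
    CGS (A ** matrix_inv M) b (M *v x\<^sub>0) (Quantities rb (\<lambda>k. M *v x k) r u p q \<alpha> \<beta>)"
proof -
  have step: "M *v x' = M *v y + a *\<^sub>R w \<longleftrightarrow> x' = y + a *\<^sub>R (matrix_inv M *v w)" for x' y w a
  proof -
    have "M *v y + a *\<^sub>R w = M *v (y + a *\<^sub>R (matrix_inv M *v w))"
      using assms
      by (simp add: matrix_vector_right_distrib matrix_vector_mult_scaleR matrix_inv_cancel)
    then show ?thesis
      by (simp add: matrix_vector_cancel[OF assms])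
  qed
  show ?thesis
    by (simp add: step matrix_vector_cancel[OF assms] matrix_inv_cancel[OF assms]
        flip: matrix_vector_mul_assoc)
qed

lemma PCGS_left_iff_CGS:
  "PCGS_left A M b x\<^sub>0 v \<longleftrightarrow> CGS (matrix_inv M ** A) (matrix_inv M *v b) x\<^sub>0 v"
  by (cases v) (simp add: matrix_vector_mult_diff_distrib flip: matrix_vector_mul_assoc)

text \<open>
  As \<open>M\<^sup>-\<^sup>1\<close> is injective, the recurrence of \<open>r\<close> may be multiplied by it without loss.
\<close>

lemma PCGS_improved1_iff_left:
  fixes A M :: "real^'n^'n"
  assumes "invertible M"
  shows "PCGS_improved1 A M b x\<^sub>0 (Quantities rs x r u p q \<alpha> \<beta>) \<longleftrightarrow>
    PCGS_left A M b x\<^sub>0 (Quantities rs x (\<lambda>k. matrix_inv M *v r k) u p q \<alpha> \<beta>)"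
proof -
  note cancel = matrix_vector_cancel[OF invertible_matrix_inv[OF assms]]
  have step: "matrix_inv M *v r' = matrix_inv M *v s - a *\<^sub>R (matrix_inv M *v w)
      \<longleftrightarrow> r' = s - a *\<^sub>R w" for r' s w a
    by (simp add: cancel flip: matrix_vector_mult_scaleR matrix_vector_mult_diff_distrib)
  show ?thesis
    by (simp add: step cancel)
qed

lemma PCGS_improved2_iff_conventional:
  "PCGS_improved2 A M b x\<^sub>0 (Quantities rs x r u p q \<alpha> \<beta>) \<longleftrightarrow>
    PCGS_conventional A M b x\<^sub>0
      (Quantities (transpose (matrix_inv M) *v rs) x r u p q \<alpha> \<beta>)"
  by simp

section \<open>The conversions as changes of basis\<close>

lemma reduces_to_conventional:
  fixes A L R :: "real^'n^'n"
  assumes L: "invertible L" and R: "invertible R"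
  shows "reduces_to conv_conventional PCGS_conventional A (L ** R) b x\<^sub>0 L R"
  unfolding reduces_to_def
proof
  fix v :: "(real^'n) quantities"
  obtain rb x r u p q \<alpha> \<beta> where v: "v = Quantities rb x r u p q \<alpha> \<beta>"
    by (cases v)
  let ?M = "L ** R" and ?T = "matrix_inv L"
  let ?w = "Quantities rb (\<lambda>k. ?M *v x k) r u p q \<alpha> \<beta>"
  have x: "?T *v (?M *v y) = R *v y" for y
    by (simp add: matrix_inv_cancel[OF L] flip: matrix_vector_mul_assoc)
  have "matrix_inv ?M ** L = matrix_inv R"
    by (simp add: matrix_inv_mult[OF L R] matrix_inv_mult_cancel[OF L] flip: matrix_mul_assoc)
  then have "?T ** (A ** matrix_inv ?M) ** matrix_inv ?T = ?T ** A ** matrix_inv R"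
    by (simp add: matrix_inv_matrix_inv[OF L] flip: matrix_mul_assoc)
  moreover have "change_basis ?T ?w = conv_conventional L R v"
    by (simp add: v x matrix_inv_matrix_inv[OF L])
  ultimately have "CGS (?T ** A ** matrix_inv R) (?T *v b) (R *v x\<^sub>0) (conv_conventional L R v)
      \<longleftrightarrow> CGS (A ** matrix_inv ?M) b (?M *v x\<^sub>0) ?w"
    using CGS_change_basis[OF invertible_matrix_inv[OF L], of "A ** matrix_inv ?M" b "?M *v x\<^sub>0" ?w]
    by (simp only: x)
  then show "CGS (?T ** A ** matrix_inv R) (?T *v b) (R *v x\<^sub>0) (conv_conventional L R v)
      \<longleftrightarrow> PCGS_conventional A ?M b x\<^sub>0 v"
    by (simp only: v PCGS_conventional_iff_CGS[OF invertible_mult[OF L R]])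
qed

lemma reduces_to_left:
  fixes A L R :: "real^'n^'n"
  assumes L: "invertible L" and R: "invertible R"
  shows "reduces_to conv_left PCGS_left A (L ** R) b x\<^sub>0 L R"
  unfolding reduces_to_def
proof
  fix v :: "(real^'n) quantities"
  let ?N = "matrix_inv (L ** R)"
  have N: "R ** ?N = matrix_inv L"
    by (simp add: matrix_inv_mult[OF L R] matrix_mul_assoc matrix_inv_mult_cancel[OF R])
  then have "R ** (?N ** A) ** matrix_inv R = matrix_inv L ** A ** matrix_inv R"
    by (simp add: matrix_mul_assoc)
  moreover have "R *v (?N *v b) = matrix_inv L *v b"
    by (simp add: matrix_vector_mul_assoc N)
  moreover have "change_basis R v = conv_left L R v"
    by (cases v) simp
  ultimately show "CGS (matrix_inv L ** A ** matrix_inv R) (matrix_inv L *v b) (R *v x\<^sub>0)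
      (conv_left L R v) \<longleftrightarrow> PCGS_left A (L ** R) b x\<^sub>0 v"
    using CGS_change_basis[OF R, of "?N ** A" "?N *v b" x\<^sub>0 v]
    by (simp only: PCGS_left_iff_CGS)
qed

text \<open>
  The two improved algorithms inherit the reduction, because the substitutions that relate them to
  the left and to the conventional one also relate the conversions:
  \<open>R (M\<^sup>-\<^sup>1 r) = L\<^sup>-\<^sup>1 r\<close> and \<open>L\<^sup>T (M\<^sup>-\<^sup>T r\<^sup>\<sharp>) = R\<^sup>-\<^sup>T r\<^sup>\<sharp>\<close>.
\<close>

lemma reduces_to_improved1:
  fixes A L R :: "real^'n^'n"
  assumes L: "invertible L" and R: "invertible R"
  shows "reduces_to conv_improved1 PCGS_improved1 A (L ** R) b x\<^sub>0 L R"
  unfolding reduces_to_def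
proof
  fix v :: "(real^'n) quantities"
  obtain rs x r u p q \<alpha> \<beta> where v: "v = Quantities rs x r u p q \<alpha> \<beta>"
    by (cases v)
  let ?w = "Quantities rs x (\<lambda>k. matrix_inv (L ** R) *v r k) u p q \<alpha> \<beta>"
  have "R ** matrix_inv (L ** R) = matrix_inv L"
    by (simp add: matrix_inv_mult[OF L R] matrix_mul_assoc matrix_inv_mult_cancel[OF R])
  then have "conv_improved1 L R v = conv_left L R ?w"
    by (simp add: v matrix_vector_mul_assoc)
  moreover have "PCGS_improved1 A (L ** R) b x\<^sub>0 v \<longleftrightarrow> PCGS_left A (L ** R) b x\<^sub>0 ?w"
    unfolding v by (rule PCGS_improved1_iff_left[OF invertible_mult[OF L R]])
  ultimately show "CGS (matrix_inv L ** A ** matrix_inv R) (matrix_inv L *v b) (R *v x\<^sub>0)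
      (conv_improved1 L R v) \<longleftrightarrow> PCGS_improved1 A (L ** R) b x\<^sub>0 v"
    using reduces_to_left[OF L R, of A b x\<^sub>0] by (simp only: reduces_to_def)
qed

lemma reduces_to_improved2:
  fixes A L R :: "real^'n^'n"
  assumes L: "invertible L" and R: "invertible R"
  shows "reduces_to conv_improved2 PCGS_improved2 A (L ** R) b x\<^sub>0 L R"
  unfolding reduces_to_def
proof
  fix v :: "(real^'n) quantities"
  obtain rs x r u p q \<alpha> \<beta> where v: "v = Quantities rs x r u p q \<alpha> \<beta>"
    by (cases v)
  let ?w = "Quantities (transpose (matrix_inv (L ** R)) *v rs) x r u p q \<alpha> \<beta>"
  have "matrix_inv (L ** R) ** L = matrix_inv R"
    by (simp add: matrix_inv_mult[OF L R] matrix_inv_mult_cancel[OF L] flip: matrix_mul_assoc)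
  then have "transpose L ** transpose (matrix_inv (L ** R)) = transpose (matrix_inv R)"
    by (simp flip: matrix_transpose_mul)
  then have "conv_improved2 L R v = conv_conventional L R ?w"
    by (simp add: v matrix_vector_mul_assoc del: transpose_matrix_vector)
  moreover have "PCGS_improved2 A (L ** R) b x\<^sub>0 v \<longleftrightarrow> PCGS_conventional A (L ** R) b x\<^sub>0 ?w"
    unfolding v by (rule PCGS_improved2_iff_conventional)
  ultimately show "CGS (matrix_inv L ** A ** matrix_inv R) (matrix_inv L *v b) (R *v x\<^sub>0)
      (conv_improved2 L R v) \<longleftrightarrow> PCGS_improved2 A (L ** R) b x\<^sub>0 v"
    using reduces_to_conventional[OF L R, of A b x\<^sub>0] by (simp only: reduces_to_def)
qed

section \<open>Congruence\<close>

lemma congruenceI: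
  fixes A M :: "real^'n^'n"
  assumes M: "invertible M"
    and two_sided: "\<And>L R. invertible L \<Longrightarrow> invertible R \<Longrightarrow>
      reduces_to conv X A (L ** R) b x\<^sub>0 L R"
  shows "congruence conv X A M b x\<^sub>0"
proof -
  have I: "invertible (mat 1 :: real^'n^'n)"
    by (auto simp: invertible_def)
  show ?thesis
    unfolding congruence_def using two_sided two_sided[OF I M] two_sided[OF M I] by simp
qed

theorem proposition1:
  fixes A M :: "real^'n^'n" and b x\<^sub>0 :: "real^'n"
  assumes "invertible A" and "invertible M"
  shows "congruence conv_conventional PCGS_conventional A M b x\<^sub>0 \<and>
         congruence conv_left PCGS_left A M b x\<^sub>0 \<and>
         congruence conv_improved1 PCGS_improved1 A M b x\<^sub>0 \<and>
         congruence conv_improved2 PCGS_improved2 A M b x\<^sub>0"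
  using assms(2)
  by (intro conjI congruenceI reduces_to_conventional reduces_to_left reduces_to_improved1
      reduces_to_improved2)

end
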